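(* There exist two diagonal holomorphic actions (of the same $\mathbb C^k$ on the same $\mathbb C^n$) whose weight configurations have uniform maximal rank and lie in the Poincaré domain, with non-empty singular supports $I$ satisfying $\dim Q_I<n-k$, whose labelled quotient maps, flat logarithmic connections with labelled support coordinates, and monodromy representations are identical, but whose labelled residual weight configurations are not linearly equivalent. Their classical transverse Camacho--Sad indices may also be different.
   Context: A diagonal action of $\mathfrak g=\mathbb C^k$ on $\mathbb C^n$ is $t\cdot z=(e^{\Lambda_j(t)}z_j)_j$ with $\Lambda_1,\dots,\Lambda_n$ spanning $\mathfrak g^*$. Uniform maximal rank: $\dim\operatorname{Span}\{\Lambda_i:i\in I\}=\min\{|I|,k\}$ for all $I$. Poincaré domain: some $\xi\in\mathfrak g$ has $\operatorname{Re}\Lambda_j(\xi)>0$ for all $j$. $I$ is a singular support if $\dim\operatorname{Span}\{\Lambda_i:i\in I\}<k$. Put $J=I^c$, $\mathfrak h_I=\bigcap_{i\in I}\ker\Lambda_i$; the labelled residual weight configuration is $(\Lambda_j|_{\mathfrak h_I})_{j\in J}$, and two such are linearly equivalent if a linear isomorphism carries each labelled weight to the one with the same label. $S_I=\{\alpha\in\mathbb N^J:\sum_j\alpha_j\Lambda_j|_{\mathfrak h_I}=0\}$ ($0\in\mathbb N$), $M_I=\operatorname{gp}(S_I)$, $Q_I=\operatorname{Spec}\mathbb C[S_I]$, and the labelled quotient map is $q_I:(\mathbb C^J,0)\to(Q_I,o_I)$, $q_I^*X^\alpha=w^\alpha$, with labelled coordinates. For independent support weights write $\sum_{j\in J}\alpha_j\Lambda_j=\sum_{i\in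 I}c_i(\alpha)\Lambda_i$, $\alpha\in M_I$. The logarithmic connection on $\mathcal O_{(\mathbb C^* )^I}\otimes\mathbb C[S_I]$ is $\nabla_I=d-\sum_{i\in I}\frac{dz_i}{z_i}\delta_i$, $\delta_iX^\alpha=c_i(\alpha)X^\alpha$; the monodromy representation of $\Gamma_I\simeq(2\pi\sqrt{-1}\,\mathbb Z)^I$ sends the $i$-th generator to the automorphism $X^\alpha\mapsto e^{2\pi\sqrt{-1}\,c_i(\alpha)}X^\alpha$ of $Q_I$. When $\dim\mathfrak h_I=1$, $J=\{j_1,j_2\}$ and all residual weights are non-zero, the transverse foliation on $(\mathbb C^J,0)$ is generated by $\lambda_{j_1}w_{j_1}\partial_{w_{j_1}}+\lambda_{j_2}w_{j_2}\partial_{w_{j_2}}$ with $\lambda_j=\Lambda_j(\xi_I)$, $0\ne\xi_I\in\mathfrak h_I$, and the transverse Camacho--Sad indices are the Camacho--Sad indices at $0$ of its separatrices $\{w_{j_2}=0\}$ and $\{w_{j_1}=0\}$. Here, for a foliation generated by $a\partial_x+b\partial_y$ with invariant curve $\{y=0\}$, the index is $\operatorname{Res}_{x=0}\partial_y(b/a)(x,0)\,dx$. *)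

theory Defs
  imports
    "HOL-Complex_Analysis.Complex_Analysis"
    "HOL-Library.Function_Algebras"
    "HOL-Library.Poly_Mapping"
    "HOL-Library.Extended_Nat"
    "HOL-Algebra.Ideal"
begin

section \<open>Finite-dimensional coordinate spaces and their duals\<close>

text \<open>
  Dimensions are quantified inside the theorem, so \<open>\<complex>\<^sup>A\<close> is the space of functions
  \<open>nat \<Rightarrow> complex\<close> vanishing off \<open>A\<close>; \<open>\<complex>\<^sup>k\<close> is the case \<open>A = {..<k}\<close>.  Addition of functions is
  pointwise; dimension and span are those of the complex vector space of functions below.
\<close>

definition cscale :: "complex \<Rightarrow> ('a \<Rightarrow> complex) \<Rightarrow> 'a \<Rightarrow> complex" where
  "cscale c f = (\<lambda>x. c * f x)"

global_interpretation cfun: vector_space "cscale :: complex \<Rightarrow> ('a \<Rightarrow> complex) \<Rightarrow> _"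
  by unfold_locales (auto simp: cscale_def algebra_simps)

definition coord_space :: "nat set \<Rightarrow> (nat \<Rightarrow> complex) set" where
  "coord_space A = {z. \<forall>i. i \<notin> A \<longrightarrow> z i = 0}"

definition linear_on :: "('a \<Rightarrow> complex) set \<Rightarrow> (('a \<Rightarrow> complex) \<Rightarrow> complex) \<Rightarrow> bool" where
  "linear_on V \<phi> \<longleftrightarrow> (\<forall>x\<in>V. \<forall>y\<in>V. \<phi> (x + y) = \<phi> x + \<phi> y) \<and> (\<forall>c. \<forall>x\<in>V. \<phi> (cscale c x) = c * \<phi> x)"

text \<open>
  A functional on a subspace \<open>V\<close> is represented by its extension by \<open>0\<close> to the whole type, so
  that equality of functionals on \<open>V\<close> is equality of functions.
\<close>

definition dual :: "('a \<Rightarrow> complex) set \<Rightarrow> (('a \<Rightarrow> complex) \<Rightarrow> complex) set" where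
  "dual V = {\<phi>. linear_on V \<phi> \<and> (\<forall>x. x \<notin> V \<longrightarrow> \<phi> x = 0)}"

definition restr :: "(('a \<Rightarrow> complex) \<Rightarrow> complex) \<Rightarrow> ('a \<Rightarrow> complex) set \<Rightarrow> ('a \<Rightarrow> complex) \<Rightarrow> complex" where
  "restr \<phi> V = (\<lambda>x. if x \<in> V then \<phi> x else 0)"

definition linear_iso ::
    "('a \<Rightarrow> complex) set \<Rightarrow> ('b \<Rightarrow> complex) set \<Rightarrow> (('a \<Rightarrow> complex) \<Rightarrow> 'b \<Rightarrow> complex) \<Rightarrow> bool" where
  "linear_iso V W T \<longleftrightarrow> bij_betw T V W \<and>
     (\<forall>x\<in>V. \<forall>y\<in>V. T (x + y) = T x + T y) \<and> (\<forall>c. \<forall>x\<in>V. T (cscale c x) = cscale c (T x))"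

section \<open>Diagonal actions and weight configurations\<close>

type_synonym weights = "nat \<Rightarrow> (nat \<Rightarrow> complex) \<Rightarrow> complex"

definition weight_configuration :: "nat \<Rightarrow> nat \<Rightarrow> weights \<Rightarrow> bool" where
  "weight_configuration k n \<Lambda> \<longleftrightarrow>
     (\<forall>j<n. \<Lambda> j \<in> dual (coord_space {..<k})) \<and>
     cfun.span (\<Lambda> ` {..<n}) = dual (coord_space {..<k})"

definition diagonal_action ::
    "nat \<Rightarrow> nat \<Rightarrow> weights \<Rightarrow> ((nat \<Rightarrow> complex) \<Rightarrow> (nat \<Rightarrow> complex) \<Rightarrow> nat \<Rightarrow> complex) \<Rightarrow> bool" where
  "diagonal_action k n \<Lambda> act \<longleftrightarrow> weight_configuration k n \<Lambda> \<and>
     (\<forall>t\<in>coord_space {..<k}. \<forall>z\<in>coord_space {..<n}.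
        act t z = (\<lambda>j. if j < n then exp (\<Lambda> j t) * z j else 0))"

definition uniform_maximal_rank :: "nat \<Rightarrow> nat \<Rightarrow> weights \<Rightarrow> bool" where
  "uniform_maximal_rank k n \<Lambda> \<longleftrightarrow>
     (\<forall>I\<subseteq>{..<n}. cfun.dim (cfun.span (\<Lambda> ` I)) = min (card I) k)"

definition poincare_domain :: "nat \<Rightarrow> nat \<Rightarrow> weights \<Rightarrow> bool" where
  "poincare_domain k n \<Lambda> \<longleftrightarrow> (\<exists>\<xi>\<in>coord_space {..<k}. \<forall>j<n. Re (\<Lambda> j \<xi>) > 0)"

definition singular_support :: "nat \<Rightarrow> nat \<Rightarrow> weights \<Rightarrow> nat set \<Rightarrow> bool" where
  "singular_support k n \<Lambda> I \<longleftrightarrow> I \<subseteq> {..<n} \<and> cfun.dim (cfun.span (\<Lambda> ` I)) < k"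

definition isotropy :: "nat \<Rightarrow> weights \<Rightarrow> nat set \<Rightarrow> (nat \<Rightarrow> complex) set" where
  "isotropy k \<Lambda> I = {t \<in> coord_space {..<k}. \<forall>i\<in>I. \<Lambda> i t = 0}"

definition residual_weight :: "nat \<Rightarrow> weights \<Rightarrow> nat set \<Rightarrow> weights" where
  "residual_weight k \<Lambda> I j = restr (\<Lambda> j) (isotropy k \<Lambda> I)"

text \<open>The residual weights live in the duals of two different subspaces.\<close>

definition linearly_equivalent_residual ::
    "nat \<Rightarrow> nat \<Rightarrow> weights \<Rightarrow> weights \<Rightarrow> nat set \<Rightarrow> bool" where
  "linearly_equivalent_residual k n \<Lambda> \<Lambda>' I \<longleftrightarrow>
     (\<exists>T. linear_iso (dual (isotropy k \<Lambda> I)) (dual (isotropy k \<Lambda>' I)) T \<and>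
        (\<forall>j\<in>{..<n} - I. T (residual_weight k \<Lambda> I j) = residual_weight k \<Lambda>' I j))"

section \<open>The resonance monoid and the labelled quotient\<close>

text \<open>
  Exponents in \<open>\<nat>\<^sup>J\<close> are finitely supported functions with support in \<open>J\<close>, and an element
  \<open>\<Sum> f\<^sub>\<alpha> X\<^sup>\<alpha>\<close> of a monoid algebra is the finitely supported function \<open>\<alpha> \<mapsto> f\<^sub>\<alpha>\<close>, on which the
  multiplication of \<^theory>\<open>HOL-Library.Poly_Mapping\<close> is convolution.
\<close>

type_synonym exponent = "nat \<Rightarrow>\<^sub>0 nat"

definition resonance_monoid :: "nat \<Rightarrow> nat \<Rightarrow> weights \<Rightarrow> nat set \<Rightarrow> exponent set" where
  "resonance_monoid k n \<Lambda> I =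
     {\<alpha>. Poly_Mapping.keys \<alpha> \<subseteq> {..<n} - I \<and>
         (\<Sum>j\<in>{..<n} - I. cscale (of_nat (Poly_Mapping.lookup \<alpha> j)) (residual_weight k \<Lambda> I j)) = 0}"

definition monoid_algebra :: "exponent set \<Rightarrow> (exponent \<Rightarrow>\<^sub>0 complex) ring" where
  "monoid_algebra S =
     \<lparr>carrier = {f. Poly_Mapping.keys f \<subseteq> S}, mult = (*), one = 1, zero = 0, add = (+)\<rparr>"

text \<open>
  The affine variety \<open>Q\<^sub>I\<close> is given by its coordinate ring, as a subalgebra of the labelled
  polynomial algebra; its dimension is the Krull dimension of that ring.
\<close>

definition quotient_ring :: "nat \<Rightarrow> nat \<Rightarrow> weights \<Rightarrow> nat set \<Rightarrow> (exponent \<Rightarrow>\<^sub>0 complex) ring" where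
  "quotient_ring k n \<Lambda> I = monoid_algebra (resonance_monoid k n \<Lambda> I)"

definition krull_dim :: "('a, 'b) ring_scheme \<Rightarrow> enat" where
  "krull_dim R = Sup {enat m | m. \<exists>P :: nat \<Rightarrow> 'a set.
     (\<forall>i\<le>m. primeideal (P i) R) \<and> (\<forall>i<m. P i \<subset> P (Suc i))}"

text \<open>
  A point \<open>w\<close> of \<open>\<complex>\<^sup>J\<close> is sent to the closed point \<open>f \<mapsto> (q\<^sup>*f)(w)\<close> of \<open>Q\<^sub>I\<close>, where \<open>q\<^sup>*X\<^sup>\<alpha> = w\<^sup>\<alpha>\<close>;
  in particular \<open>0\<close> is sent to \<open>o\<^sub>I\<close>.  The map is polynomial, hence determined by its germ at \<open>0\<close>.
\<close>

definition labelled_quotient_map ::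
    "nat \<Rightarrow> nat \<Rightarrow> weights \<Rightarrow> nat set \<Rightarrow> (nat \<Rightarrow> complex) \<Rightarrow> (exponent \<Rightarrow>\<^sub>0 complex) \<Rightarrow> complex" where
  "labelled_quotient_map k n \<Lambda> I =
     (\<lambda>w\<in>coord_space ({..<n} - I). \<lambda>f\<in>carrier (quotient_ring k n \<Lambda> I).
        \<Sum>\<alpha>\<in>Poly_Mapping.keys f.
          Poly_Mapping.lookup f \<alpha> * (\<Prod>j\<in>{..<n} - I. w j ^ Poly_Mapping.lookup \<alpha> j))"

section \<open>The logarithmic connection and its monodromy\<close>

text \<open>
  \<open>\<Sum>\<^sub>j \<alpha>\<^sub>j \<Lambda>\<^sub>j = \<Sum>\<^sub>i c\<^sub>i(\<alpha>) \<Lambda>\<^sub>i\<close>.  For independent support weights the coefficients exist and are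
  unique whenever \<open>\<alpha>\<close> lies in the resonance monoid, since then the left-hand side vanishes on the
  common kernel of the support weights.
\<close>

definition support_coeff :: "nat \<Rightarrow> weights \<Rightarrow> nat set \<Rightarrow> exponent \<Rightarrow> nat \<Rightarrow> complex" where
  "support_coeff n \<Lambda> I \<alpha> = (THE c. c \<in> coord_space I \<and>
     (\<Sum>j\<in>{..<n} - I. cscale (of_nat (Poly_Mapping.lookup \<alpha> j)) (\<Lambda> j)) = (\<Sum>i\<in>I. cscale (c i) (\<Lambda> i)))"

definition support_torus :: "nat set \<Rightarrow> (nat \<Rightarrow> complex) set" where
  "support_torus I = {z \<in> coord_space I. \<forall>i\<in>I. z i \<noteq> 0}"

text \<open>By Osgood's lemma, continuity and separate holomorphy give joint holomorphy.\<close>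

definition holomorphic_coord :: "nat set \<Rightarrow> (nat \<Rightarrow> complex) set \<Rightarrow> ((nat \<Rightarrow> complex) \<Rightarrow> complex) \<Rightarrow> bool" where
  "holomorphic_coord I U f \<longleftrightarrow> continuous_on U f \<and>
     (\<forall>z\<in>U. \<forall>i\<in>I. (\<lambda>u. f (z(i := u))) field_differentiable at (z i))"

text \<open>
  Sections over \<open>U\<close> of \<open>\<O> \<otimes> \<complex>[S]\<close> are finite sums \<open>\<Sum> s\<^sub>\<alpha> X\<^sup>\<alpha>\<close> with holomorphic coefficients,
  extended by \<open>0\<close> off \<open>U\<close>.
\<close>

definition section_space ::
    "nat set \<Rightarrow> exponent set \<Rightarrow> (nat \<Rightarrow> complex) set \<Rightarrow> (exponent \<Rightarrow>\<^sub>0 ((nat \<Rightarrow> complex) \<Rightarrow> complex)) set" where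
  "section_space I S U = {s. Poly_Mapping.keys s \<subseteq> S \<and>
     (\<forall>\<alpha>. holomorphic_coord I U (Poly_Mapping.lookup s \<alpha>) \<and>
          (\<forall>z. z \<notin> U \<longrightarrow> Poly_Mapping.lookup s \<alpha> z = 0))}"

text \<open>
  \<open>log_connection k n \<Lambda> I U s i\<close> is the coefficient of \<open>dz\<^sub>i\<close> in \<open>\<nabla>\<^sub>I s\<close> over the open set \<open>U\<close>, namely
  \<open>\<Sum> (\<partial>s\<^sub>\<alpha>/\<partial>z\<^sub>i - c\<^sub>i(\<alpha>) s\<^sub>\<alpha>/z\<^sub>i) X\<^sup>\<alpha>\<close>.  The function type carries the product topology.
\<close>

definition log_connection ::
    "nat \<Rightarrow> nat \<Rightarrow> weights \<Rightarrow> nat set \<Rightarrow> (nat \<Rightarrow> complex) set \<Rightarrow>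
     (exponent \<Rightarrow>\<^sub>0 ((nat \<Rightarrow> complex) \<Rightarrow> complex)) \<Rightarrow> nat \<Rightarrow> (exponent \<Rightarrow>\<^sub>0 ((nat \<Rightarrow> complex) \<Rightarrow> complex))" where
  "log_connection k n \<Lambda> I =
     (\<lambda>U\<in>{U. openin (top_of_set (support_torus I)) U}.
      \<lambda>s\<in>section_space I (resonance_monoid k n \<Lambda> I) U. \<lambda>i\<in>I.
        Poly_Mapping.mapp (\<lambda>\<alpha> f z. if z \<in> U
            then deriv (\<lambda>u. f (z(i := u))) (z i) - support_coeff n \<Lambda> I \<alpha> i * f z / z i
            else 0) s)"

definition support_lattice :: "nat set \<Rightarrow> (nat \<Rightarrow> complex) set" where
  "support_lattice I = {\<gamma> \<in> coord_space I. \<forall>i\<in>I. \<exists>m::int. \<gamma> i = 2 * of_real pi * \<i> * of_int m}"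

text \<open>The automorphism of \<open>Q\<^sub>I\<close> attached to \<open>\<gamma>\<close> is given on the coordinate ring.\<close>

definition monodromy ::
    "nat \<Rightarrow> nat \<Rightarrow> weights \<Rightarrow> nat set \<Rightarrow> (nat \<Rightarrow> complex) \<Rightarrow>
     (exponent \<Rightarrow>\<^sub>0 complex) \<Rightarrow> (exponent \<Rightarrow>\<^sub>0 complex)" where
  "monodromy k n \<Lambda> I =
     (\<lambda>\<gamma>\<in>support_lattice I. \<lambda>f\<in>carrier (quotient_ring k n \<Lambda> I).
        Poly_Mapping.mapp (\<lambda>\<alpha> a. exp (\<Sum>i\<in>I. \<gamma> i * support_coeff n \<Lambda> I \<alpha> i) * a) f)"

section \<open>Transverse Camacho--Sad indices\<close>

text \<open>
  The index at \<open>0\<close> of \<open>{y = 0}\<close> for the foliation generated by \<open>a \<partial>\<^sub>x + b \<partial>\<^sub>y\<close>; it is meaningful when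
  \<open>{y = 0}\<close> is invariant, that is \<open>b x 0 = 0\<close>.
\<close>

definition camacho_sad :: "(complex \<Rightarrow> complex \<Rightarrow> complex) \<Rightarrow> (complex \<Rightarrow> complex \<Rightarrow> complex) \<Rightarrow> complex" where
  "camacho_sad a b = residue (\<lambda>x. deriv (\<lambda>y. b x y / a x y) 0) 0"

definition transverse_field :: "nat \<Rightarrow> weights \<Rightarrow> nat set \<Rightarrow> (nat \<Rightarrow> complex) \<Rightarrow> (nat \<Rightarrow> complex) \<Rightarrow> nat \<Rightarrow> complex" where
  "transverse_field n \<Lambda> I \<xi> w = (\<lambda>j. if j \<in> {..<n} - I then \<Lambda> j \<xi> * w j else 0)"

text \<open>For \<open>J = {j, j'}\<close>: the index of the separatrix \<open>{w\<^sub>j\<^sub>' = 0}\<close>, with \<open>x = w\<^sub>j\<close> and \<open>y = w\<^sub>j\<^sub>'\<close>.\<close>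

definition transverse_index :: "nat \<Rightarrow> weights \<Rightarrow> nat set \<Rightarrow> (nat \<Rightarrow> complex) \<Rightarrow> nat \<Rightarrow> nat \<Rightarrow> complex" where
  "transverse_index n \<Lambda> I \<xi> j j' =
     camacho_sad (\<lambda>x y. transverse_field n \<Lambda> I \<xi> ((\<lambda>_. 0)(j := x, j' := y)) j)
                 (\<lambda>x y. transverse_field n \<Lambda> I \<xi> ((\<lambda>_. 0)(j := x, j' := y)) j')"

end

theory Submission
  imports Defs
begin

text \<open>
  Take \<open>k = 2\<close>, \<open>n = 3\<close>, \<open>I = {0}\<close> and the weights \<open>t\<^sub>0, t\<^sub>1, t\<^sub>0 + c t\<^sub>1\<close> with \<open>Re c > 0\<close>.  On the
  isotropy line \<open>t\<^sub>0 = 0\<close> they restrict to \<open>t\<^sub>1\<close> and \<open>c t\<^sub>1\<close>, so there is no non-trivial resonance: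
  the quotient is a point, and the quotient map, the connection and the monodromy do not see \<open>c\<close>.
  The residual weights do, as do the Camacho--Sad indices \<open>c\<close> and \<open>1 / c\<close>; compare \<open>c = 1\<close> with
  \<open>c = 2\<close>.
\<close>

section \<open>Actions without resonance\<close>

text \<open>Elements supported on the exponent 0 are constants, so the algebra is a copy of the
  field of complex numbers. A strict inclusion of primes would put a non-zero constant into the
  larger one; multiplying by its inverse gives 1, against properness.\<close>

lemma krull_dim_trivial_monoid_algebra: "krull_dim (monoid_algebra {0}) = 0"
proof -
  have no_chain: False if P: "primeideal P (monoid_algebra {0})" and sub: "A \<subset> P"
      and A: "primeideal A (monoid_algebra {0})" for A P
  proof -
    interpret P: primeideal P "monoid_algebra {0}" by (rule P)
    interpret A: primeideal A "monoid_algebra {0}" by (rule A)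
    have "0 \<in> A"
      using A.zero_closed by (simp add: monoid_algebra_def)
    then obtain f where f: "f \<in> P" "f \<noteq> 0"
      using sub by auto
    have "Poly_Mapping.keys f \<subseteq> {0}"
      using P.Icarr[OF f(1)] by (simp add: monoid_algebra_def)
    then have "f = Poly_Mapping.single 0 (Poly_Mapping.lookup f 0)"
      by (intro poly_mapping_eqI) (auto simp: lookup_single when_def in_keys_iff)
    then obtain a where a: "f = Poly_Mapping.single 0 a" ..
    with f(2) have "a \<noteq> 0" by auto
    have "Poly_Mapping.single 0 (inverse a) \<otimes>\<^bsub>monoid_algebra {0}\<^esub> f \<in> P"
      by (rule P.I_l_closed[OF f(1)]) (simp add: monoid_algebra_def)
    moreover have "Poly_Mapping.single 0 (inverse a) \<otimes>\<^bsub>monoid_algebra {0}\<^esub> f = \<one>\<^bsub>monoid_algebra {0}\<^esub>"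
      using \<open>a \<noteq> 0\<close> by (simp add: monoid_algebra_def a mult_single)
    ultimately show False
      using P.one_imp_carrier P.I_notcarr by simp
  qed
  \<comment> \<open>A chain of length m has m + 1 primes, so a positive m already yields the strict
    inclusion \<open>P 0 \<subset> P (Suc 0)\<close>.\<close>
  have "enat m \<le> 0" if "\<forall>i\<le>m. primeideal (P i) (monoid_algebra {0})" "\<forall>i<m. P i \<subset> P (Suc i)"
    for m and P :: "nat \<Rightarrow> (exponent \<Rightarrow>\<^sub>0 complex) set"
  proof (cases m)
    case (Suc l)
    then show ?thesis
      using no_chain[of "P (Suc 0)" "P 0"] that by auto
  qed (simp add: zero_enat_def)
  then have "krull_dim (monoid_algebra {0}) \<le> 0"
    unfolding krull_dim_def by (intro Sup_least) blast
  \<comment> \<open>The reverse inequality is automatic, 0 being the least element of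
    \<open>enat\<close>.\<close>
  then show ?thesis by simp
qed

text \<open>At \<open>\<alpha> = 0\<close> the equation defining the coefficients only involves the support weights.\<close>

lemma support_coeff_zero_cong:
  assumes "\<And>i. i \<in> I \<Longrightarrow> \<Lambda> i = \<Lambda>' i"
  shows "support_coeff n \<Lambda> I 0 = support_coeff n \<Lambda>' I 0"
  using assms by (simp add: support_coeff_def cscale_def)

text \<open>\<open>mapp\<close> consults its function only at keys and returns 0 elsewhere. This
  reduces the comparison of connections and of monodromies to the exponents that actually
  occur.\<close>

lemma mapp_cong_keys:
  assumes "\<And>\<alpha>. \<alpha> \<in> Poly_Mapping.keys s \<Longrightarrow> f \<alpha> = g \<alpha>"
  shows "Poly_Mapping.mapp f s = Poly_Mapping.mapp g s"
  by (rule poly_mapping_eqI) (simp add: lookup_mapp assms when_def)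

text \<open>Both connections act on the same sections, and the only possible exponent of a section
  is 0. There the two \<open>THE\<close> terms in \<open>support_coeff\<close> have the same
  defining predicate, since the support weights agree.\<close>

lemma log_connection_cong:
  assumes "resonance_monoid k n \<Lambda> I = {0}" "resonance_monoid k n \<Lambda>' I = {0}"
    and "\<And>i. i \<in> I \<Longrightarrow> \<Lambda> i = \<Lambda>' i"
  shows "log_connection k n \<Lambda> I = log_connection k n \<Lambda>' I"
  unfolding log_connection_def assms(1,2)
proof (intro restrict_ext mapp_cong_keys)
  fix U s i \<alpha>
  assume "s \<in> section_space I {0} U" "\<alpha> \<in> Poly_Mapping.keys s"
  then have "\<alpha> = 0" by (auto simp: section_space_def)
  then have *: "support_coeff n \<Lambda> I \<alpha> = support_coeff n \<Lambda>' I \<alpha>"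
    using support_coeff_zero_cong assms(3) by blast
  show "(\<lambda>f z. if z \<in> U
            then deriv (\<lambda>u. f (z(i := u))) (z i) - support_coeff n \<Lambda> I \<alpha> i * f z / z i
            else 0) =
        (\<lambda>f z. if z \<in> U
            then deriv (\<lambda>u. f (z(i := u))) (z i) - support_coeff n \<Lambda>' I \<alpha> i * f z / z i
            else 0)"
    by (simp only: *)
qed

text \<open>As for the connection: elements of the coordinate ring involve only the exponent 0,
  where the coefficients in the exponential agree.\<close>

lemma monodromy_cong:
  assumes "resonance_monoid k n \<Lambda> I = {0}" "resonance_monoid k n \<Lambda>' I = {0}"
    and "\<And>i. i \<in> I \<Longrightarrow> \<Lambda> i = \<Lambda>' i"
  shows "monodromy k n \<Lambda> I = monodromy k n \<Lambda>' I"
  unfolding monodromy_def quotient_ring_def assms(1,2)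
proof (intro restrict_ext mapp_cong_keys)
  fix \<gamma> f \<alpha>
  assume "f \<in> carrier (monoid_algebra {0})" "\<alpha> \<in> Poly_Mapping.keys f"
  then have "\<alpha> = 0" by (auto simp: monoid_algebra_def)
  then have *: "support_coeff n \<Lambda> I \<alpha> = support_coeff n \<Lambda>' I \<alpha>"
    using support_coeff_zero_cong assms(3) by blast
  show "(*) (exp (\<Sum>i\<in>I. \<gamma> i * support_coeff n \<Lambda> I \<alpha> i)) =
        (*) (exp (\<Sum>i\<in>I. \<gamma> i * support_coeff n \<Lambda>' I \<alpha> i))"
    by (simp only: *)
qed

section \<open>Camacho--Sad indices of linear diagonal fields\<close>

lemma camacho_sad_linear:
  assumes "a \<noteq> 0"
  shows "camacho_sad (\<lambda>x y. a * x) (\<lambda>x y. b * y) = b / a"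
proof -
  \<comment> \<open>The quotient is linear in y with slope \<open>(b / a) / x\<close>, a simple pole
    in x. The identity includes x = 0, where division by zero makes both sides 0; the form
    \<open>x - 0\<close> is the one that \<open>residue_simple\<close> matches.\<close>
  have "deriv (\<lambda>y. b * y / (a * x)) 0 = (b / a) / (x - 0)" for x
  proof -
    have "((\<lambda>y. (b / a / x) * y) has_field_derivative (b / a / x) * 1) (at 0)"
      by (rule DERIV_cmult[OF DERIV_ident])
    then have "((\<lambda>y. b * y / (a * x)) has_field_derivative b / a / x) (at 0)"
      by (simp add: field_simps)
    then show ?thesis by (simp add: DERIV_imp_deriv)
  qed
  then have "camacho_sad (\<lambda>x y. a * x) (\<lambda>x y. b * y) = residue (\<lambda>x. (b / a) / (x - 0)) 0"
    by (simp only: camacho_sad_def)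
  also have "\<dots> = b / a"
    by (rule residue_simple[where s = UNIV]) auto
  finally show ?thesis .
qed

lemma transverse_index_eq:
  assumes "{..<n} - I = {j, j'}" "j \<noteq> j'" "\<Lambda> j \<xi> \<noteq> 0"
  shows "transverse_index n \<Lambda> I \<xi> j j' = \<Lambda> j' \<xi> / \<Lambda> j \<xi>"
  using camacho_sad_linear[OF assms(3), of "\<Lambda> j' \<xi>"] assms(2)
  by (simp add: transverse_index_def transverse_field_def assms(1))

section \<open>Configurations in the plane\<close>

text \<open>Cutting off outside the plane gives the normal form required by \<open>dual\<close>, so
  that equal functionals are equal functions.\<close>

definition planar_form :: "complex \<Rightarrow> complex \<Rightarrow> (nat \<Rightarrow> complex) \<Rightarrow> complex" where
  "planar_form a b = restr (\<lambda>t. a * t 0 + b * t 1) (coord_space {..<2})"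

definition planar_vector :: "complex \<Rightarrow> complex \<Rightarrow> nat \<Rightarrow> complex" where
  "planar_vector x y = (\<lambda>_. 0)(0 := x, 1 := y)"

lemma planar_vector_simps [simp]:
  "planar_vector x y 0 = x" "planar_vector x y (Suc 0) = y"
  by (simp_all add: planar_vector_def)

lemma planar_vector_eq_iff [simp]: "planar_vector x y = planar_vector x' y' \<longleftrightarrow> x = x' \<and> y = y'"
  by (metis planar_vector_simps)

lemma planar_vector_0: "planar_vector 0 0 = 0"
  by (simp add: planar_vector_def fun_eq_iff)

lemma planar_vector_add: "planar_vector x y + planar_vector x' y' = planar_vector (x + x') (y + y')"
  by (simp add: planar_vector_def fun_eq_iff)

lemma cscale_planar_vector: "cscale c (planar_vector x y) = planar_vector (c * x) (c * y)"
  by (simp add: planar_vector_def cscale_def fun_eq_iff)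

lemma planar_vector_mem [simp]: "planar_vector x y \<in> coord_space {..<2}"
  by (auto simp: coord_space_def planar_vector_def)

lemma planar_vector_cases:
  assumes "t \<in> coord_space {..<2}"
  shows "t = planar_vector (t 0) (t 1)"
  using assms by (auto simp: coord_space_def planar_vector_def fun_eq_iff)

lemma planar_form_apply [simp]: "planar_form a b (planar_vector x y) = a * x + b * y"
  by (simp add: planar_form_def restr_def)

lemma planar_form_add: "planar_form a b + planar_form a' b' = planar_form (a + a') (b + b')"
  by (auto simp: planar_form_def restr_def fun_eq_iff algebra_simps)

lemma cscale_planar_form: "cscale c (planar_form a b) = planar_form (c * a) (c * b)"
  by (auto simp: planar_form_def restr_def cscale_def fun_eq_iff algebra_simps)

lemma planar_form_eq_iff [simp]: "planar_form a b = planar_form a' b' \<longleftrightarrow> a = a' \<and> b = b'"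
proof
  assume eq: "planar_form a b = planar_form a' b'"
  show "a = a' \<and> b = b'"
    using arg_cong[OF eq, of "\<lambda>f. f (planar_vector 1 0)"]
      arg_cong[OF eq, of "\<lambda>f. f (planar_vector 0 1)"] by simp
qed simp

lemma planar_form_0: "planar_form 0 0 = 0"
  by (simp add: planar_form_def restr_def fun_eq_iff)

text \<open>The coefficients of a functional are its values at the two basis vectors; off the plane
  both sides are 0.\<close>

lemma dual_plane: "dual (coord_space {..<2}) = range (\<lambda>(a, b). planar_form a b)"
proof (intro subset_antisym subsetI)
  fix \<phi> assume \<phi>: "\<phi> \<in> dual (coord_space {..<2})"
  let ?e = "planar_vector 1 0" and ?f = "planar_vector 0 1"
  have "\<phi> t = planar_form (\<phi> ?e) (\<phi> ?f) t" for t
  proof (cases "t \<in> coord_space {..<2}")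
    case True
    have t: "t = cscale (t 0) ?e + cscale (t 1) ?f"
      by (subst planar_vector_cases[OF True]) (simp add: cscale_planar_vector planar_vector_add)
    have mem: "cscale c (planar_vector x y) \<in> coord_space {..<2}" for c x y
      by (simp add: cscale_planar_vector)
    have "\<phi> t = t 0 * \<phi> ?e + t 1 * \<phi> ?f"
      using \<phi> planar_vector_mem mem by (subst t) (auto simp: dual_def linear_on_def)
    then show ?thesis
      using True by (simp add: planar_form_def restr_def)
  next
    case False
    then show ?thesis
      using \<phi> by (simp add: planar_form_def restr_def dual_def)
  qed
  then have "\<phi> = planar_form (\<phi> ?e) (\<phi> ?f)" ..
  then show "\<phi> \<in> range (\<lambda>(a, b). planar_form a b)"
    by (metis case_prod_conv rangeI)
next
  fix \<phi> assume "\<phi> \<in> range (\<lambda>(a, b). planar_form a b)"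
  then show "\<phi> \<in> dual (coord_space {..<2})"
    by (auto simp: planar_form_def restr_def dual_def linear_on_def coord_space_def cscale_def
        algebra_simps)
qed

lemma span_planar_pair:
  assumes "a * b' \<noteq> a' * b"
  shows "cfun.span {planar_form a b, planar_form a' b'} = dual (coord_space {..<2})"
proof (intro subset_antisym subsetI)
  fix \<phi> assume "\<phi> \<in> cfun.span {planar_form a b, planar_form a' b'}"
  then obtain u v where "\<phi> - cscale u (planar_form a b) = cscale v (planar_form a' b')"
    by (auto simp: cfun.span_breakdown_eq[of _ _ "{planar_form a' b'}"] cfun.span_singleton)
  then have "\<phi> = planar_form (u * a + v * a') (u * b + v * b')"
    by (simp add: cscale_planar_form planar_form_add algebra_simps diff_eq_eq)
  then show "\<phi> \<in> dual (coord_space {..<2})" by (auto simp: dual_plane)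
next
  fix \<phi> assume "\<phi> \<in> dual (coord_space {..<2})"
  then obtain x y where \<phi>: "\<phi> = planar_form x y" by (auto simp: dual_plane)
  define d where "d = a * b' - a' * b"
  have "d \<noteq> 0" using assms by (simp add: d_def)
  \<comment> \<open>Cramer's rule for \<open>u * a + v * a' = x\<close> and
    \<open>u * b + v * b' = y\<close>, with determinant d.\<close>
  let ?u = "(x * b' - y * a') / d" and ?v = "(y * a - x * b) / d"
  have "?u * a + ?v * a' = x * d / d" "?u * b + ?v * b' = y * d / d"
    unfolding d_def by (simp_all add: algebra_simps add_divide_distrib diff_divide_distrib)
  then have "\<phi> = cscale ?u (planar_form a b) + cscale ?v (planar_form a' b')"
    using \<open>d \<noteq> 0\<close> by (simp add: \<phi> cscale_planar_form planar_form_add)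
  then show "\<phi> \<in> cfun.span {planar_form a b, planar_form a' b'}"
    by (metis cfun.span_add cfun.span_scale cfun.span_base insertI1 insertI2)
qed

lemma independent_planar_pair:
  assumes "a * b' \<noteq> a' * b"
  shows "\<not> cfun.dependent {planar_form a b, planar_form a' b'}"
proof -
  have "planar_form a' b' \<noteq> 0" "planar_form a b \<noteq> cscale c (planar_form a' b')" for c
    using assms by (auto simp: cscale_planar_form simp flip: planar_form_0)
  then show ?thesis
    by (auto simp: cfun.independent_insert cfun.span_singleton)
qed

lemma dim_dual_plane: "cfun.dim (dual (coord_space {..<2})) = 2"
proof -
  have "cfun.dim (cfun.span {planar_form 1 0, planar_form 0 1}) = card {planar_form 1 0, planar_form 0 1}"
    by (intro cfun.dim_span_eq_card_independent independent_planar_pair) simp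
  then show ?thesis by (simp add: span_planar_pair)
qed

text \<open>The rank saturates at 2, so three cases suffice: the empty set, a singleton with
  non-zero weight, and any set with two distinct indices, whose pair of weights already spans the
  dual plane.\<close>

lemma uniform_maximal_rank_planar:
  assumes \<Lambda>: "\<And>j. j < n \<Longrightarrow> \<Lambda> j = planar_form (a j) (b j)"
    and nz: "\<And>j. j < n \<Longrightarrow> \<Lambda> j \<noteq> 0"
    and det: "\<And>i j. i < n \<Longrightarrow> j < n \<Longrightarrow> i \<noteq> j \<Longrightarrow> a i * b j \<noteq> a j * b i"
  shows "uniform_maximal_rank 2 n \<Lambda>"
  unfolding uniform_maximal_rank_def
proof (intro allI impI)
  fix I assume I: "I \<subseteq> {..<n}"
  then have "finite I" by (rule finite_subset) simp
  consider "I = {}" | i where "I = {i}" | i j where "i \<in> I" "j \<in> I" "i \<noteq> j"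
    by blast
  then show "cfun.dim (cfun.span (\<Lambda> ` I)) = min (card I) 2"
  proof cases
    case 1
    then show ?thesis
      using cfun.dim_span_eq_card_independent[OF cfun.independent_empty] by simp
  next
    case 2
    then have "\<not> cfun.dependent {\<Lambda> i}" using nz I by simp
    then show ?thesis
      using cfun.dim_span_eq_card_independent[of "{\<Lambda> i}"] 2 by simp
  next
    case 3
    \<comment> \<open>The dual plane is a subspace because it is the span of a pair of
      forms.\<close>
    have "cfun.subspace (dual (coord_space {..<2}))"
      by (metis cfun.subspace_span span_planar_pair mult_1 zero_neq_one)
    then have "cfun.span (\<Lambda> ` I) \<subseteq> dual (coord_space {..<2})"
      using I \<Lambda> by (intro cfun.span_minimal) (fastforce simp: dual_plane)+
    moreover have "cfun.span {\<Lambda> i, \<Lambda> j} = dual (coord_space {..<2})"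
    proof -
      have "i < n" "j < n" using 3 I by auto
      with det 3 show ?thesis by (simp add: \<Lambda> span_planar_pair)
    qed
    moreover have "cfun.span {\<Lambda> i, \<Lambda> j} \<subseteq> cfun.span (\<Lambda> ` I)"
      using 3 by (intro cfun.span_mono) auto
    ultimately have "cfun.span (\<Lambda> ` I) = dual (coord_space {..<2})" by simp
    moreover have "2 \<le> card I"
      using 3 \<open>finite I\<close> card_mono[of I "{i, j}"] by simp
    ultimately show ?thesis by (simp add: dim_dual_plane)
  qed
qed

section \<open>The one-parameter family of configurations\<close>

definition triple :: "complex \<Rightarrow> weights" where
  "triple c j = (if j = 0 then planar_form 1 0 else if j = 1 then planar_form 0 1 else planar_form 1 c)"

lemma triple_simps [simp]:
  "triple c 0 = planar_form 1 0" "triple c 1 = planar_form 0 1" "triple c (Suc 0) = planar_form 0 1"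
  "triple c 2 = planar_form 1 c"
  by (simp_all add: triple_def)

lemma less_3_cases: "j < (3::nat) \<Longrightarrow> j = 0 \<or> j = 1 \<or> j = 2"
  by auto

lemma support_complement: "{..<3} - {0} = {1, 2 :: nat}"
  by auto

lemma weight_configuration_triple: "weight_configuration 2 3 (triple c)"
proof -
  have sub: "triple c ` {..<3} \<subseteq> dual (coord_space {..<2})"
    by (auto simp: dual_plane triple_def)
  have span: "cfun.span {planar_form 1 0, planar_form 0 1} = dual (coord_space {..<2})"
    by (rule span_planar_pair) simp
  have "{planar_form 1 0, planar_form 0 1} = triple c ` {0, 1}"
    by simp
  also have "\<dots> \<subseteq> triple c ` {..<3}"
    by (intro image_mono) auto
  finally have "dual (coord_space {..<2}) \<subseteq> cfun.span (triple c ` {..<3})"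
    using cfun.span_mono span by metis
  moreover have "cfun.span (triple c ` {..<3}) \<subseteq> dual (coord_space {..<2})"
    using sub span cfun.span_minimal cfun.subspace_span by metis
  ultimately show ?thesis
    using sub by (auto simp: weight_configuration_def)
qed

text \<open>Up to sign the pairwise determinants are 1, c and 1.\<close>

lemma uniform_maximal_rank_triple:
  assumes "c \<noteq> 0"
  shows "uniform_maximal_rank 2 3 (triple c)"
proof (rule uniform_maximal_rank_planar[where a = "\<lambda>j. if j = 1 then 0 else 1"
      and b = "\<lambda>j. if j = 0 then 0 else if j = 1 then 1 else c"])
  \<comment> \<open>Here j is unrestricted: the last branch of \<open>triple\<close> gives every
    index from 2 on the third weight.\<close>
  show "triple c j \<noteq> 0" for j
    by (simp add: triple_def flip: planar_form_0)
qed (use assms in \<open>auto simp: triple_def dest!: less_3_cases\<close>)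

lemma poincare_domain_triple:
  assumes "Re c > 0"
  shows "poincare_domain 2 3 (triple c)"
  unfolding poincare_domain_def
  \<comment> \<open>At (1, 1) the three weights take the values 1, 1 and 1 + c.\<close>
  by (rule bexI[of _ "planar_vector 1 1"]) (use assms in \<open>auto simp: triple_def\<close>)

section \<open>The isotropy line, its residual weights and the resonances\<close>

lemma isotropy_triple: "isotropy 2 (triple c) {0} = range (planar_vector 0)"
proof (intro subset_antisym subsetI)
  fix t assume "t \<in> isotropy 2 (triple c) {0}"
  then have t: "t \<in> coord_space {..<2}" "planar_form 1 0 t = 0"
    by (auto simp: isotropy_def)
  then have "t 0 = 0" by (simp add: planar_form_def restr_def)
  then show "t \<in> range (planar_vector 0)"
    using planar_vector_cases[OF t(1)] by simp
qed (auto simp: isotropy_def)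

lemma dim_isotropy_triple: "cfun.dim (isotropy 2 (triple c) {0}) = 1"
proof -
  have "isotropy 2 (triple c) {0} = cfun.span {planar_vector 0 1}"
    by (auto simp: isotropy_triple cfun.span_singleton cscale_planar_vector)
  moreover have "\<not> cfun.dependent {planar_vector 0 1}"
    by (simp flip: planar_vector_0)
  ultimately show ?thesis
    using cfun.dim_span_eq_card_independent[of "{planar_vector 0 1}"] by simp
qed

lemma residual_weight_triple [simp]:
  "residual_weight 2 (triple c) {0} j (planar_vector 0 s) = triple c j (planar_vector 0 s)"
  by (simp add: residual_weight_def restr_def isotropy_triple)

lemma residual_weight_triple_2:
  "residual_weight 2 (triple c) {0} 2 = cscale c (residual_weight 2 (triple c) {0} 1)"
  by (auto simp: residual_weight_def restr_def isotropy_triple cscale_def fun_eq_iff)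

lemma residual_weight_triple_nonzero: "residual_weight 2 (triple c) {0} 1 \<noteq> 0"
proof
  assume "residual_weight 2 (triple c) {0} 1 = 0"
  then have "residual_weight 2 (triple c) {0} 1 (planar_vector 0 1) = 0" by simp
  then show False by simp
qed

text \<open>Evaluating a resonance at (0, 1) gives \<alpha>_1 + \<alpha>_2 c = 0. In its real part
  both summands are non-negative and \<open>Re c > 0\<close>, so both exponents vanish.\<close>

lemma resonance_monoid_triple:
  assumes "Re c > 0"
  shows "resonance_monoid 2 3 (triple c) {0} = {0}"
proof (intro subset_antisym subsetI)
  fix \<alpha> assume \<alpha>: "\<alpha> \<in> resonance_monoid 2 3 (triple c) {0}"
  let ?\<rho> = "residual_weight 2 (triple c) {0}" and ?l = "Poly_Mapping.lookup \<alpha>"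
  have "cscale (of_nat (?l 1)) (?\<rho> 1) + cscale (of_nat (?l 2)) (?\<rho> 2) = 0"
    using \<alpha> by (simp add: resonance_monoid_def support_complement)
  then have "(cscale (of_nat (?l 1)) (?\<rho> 1) + cscale (of_nat (?l 2)) (?\<rho> 2)) (planar_vector 0 1) = 0"
    by simp
  then have "of_nat (?l 1) + of_nat (?l 2) * c = 0"
    by (simp add: cscale_def)
  then have "real (?l 1) + real (?l 2) * Re c = 0"
    by (auto simp: complex_eq_iff)
  then have "?l 1 = 0 \<and> ?l 2 = 0"
    using assms by (simp add: add_nonneg_eq_0_iff)
  moreover have "Poly_Mapping.keys \<alpha> \<subseteq> {1, 2}"
    using \<alpha> by (simp add: resonance_monoid_def support_complement)
  ultimately have "Poly_Mapping.keys \<alpha> = {}"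
    using in_keys_iff by (metis insertE subset_iff all_not_in_conv)
  then show "\<alpha> \<in> {0}" by simp
qed (simp add: resonance_monoid_def cscale_def flip: zero_fun_def)

text \<open>On the isotropy line \<open>\<xi> = planar_vector 0 s\<close> the residual weights take
  the values s and c s. The indices are their two ratios, from which s cancels, so the choice of
  generator does not matter.\<close>

lemma transverse_index_triple:
  assumes "\<xi> \<in> isotropy 2 (triple c) {0} - {0}"
  shows "transverse_index 3 (triple c) {0} \<xi> 1 2 = c"
    and "c \<noteq> 0 \<Longrightarrow> transverse_index 3 (triple c) {0} \<xi> 2 1 = 1 / c"
proof -
  obtain s where s: "\<xi> = planar_vector 0 s"
    using assms by (auto simp: isotropy_triple)
  then have "s \<noteq> 0"
    using assms by (auto simp: planar_vector_0)
  then have vals: "triple c 1 \<xi> = s" "triple c 2 \<xi> = c * s"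
    by (simp_all add: s)
  show "transverse_index 3 (triple c) {0} \<xi> 1 2 = c"
    using vals \<open>s \<noteq> 0\<close> by (subst transverse_index_eq) auto
  show "transverse_index 3 (triple c) {0} \<xi> 2 1 = 1 / c" if "c \<noteq> 0"
    using vals \<open>s \<noteq> 0\<close> that by (subst transverse_index_eq) auto
qed

text \<open>For parameter 1 the residual weights with labels 1 and 2 coincide, so their images under
  T coincide as well. For c different from 1 the target weights are a non-zero functional and c
  times it, hence distinct.\<close>

lemma not_linearly_equivalent_triple:
  assumes "c \<noteq> 1"
  shows "\<not> linearly_equivalent_residual 2 3 (triple 1) (triple c) {0}"
proof
  let ?\<rho> = "\<lambda>c. residual_weight 2 (triple c) {0}"
  assume "linearly_equivalent_residual 2 3 (triple 1) (triple c) {0}"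
  then obtain T where "T (?\<rho> 1 1) = ?\<rho> c 1" "T (?\<rho> 1 2) = ?\<rho> c 2"
    by (auto simp: linearly_equivalent_residual_def support_complement)
  moreover have "?\<rho> 1 2 = ?\<rho> 1 1"
    by (simp only: residual_weight_triple_2 cfun.scale_one)
  ultimately have "cscale c (?\<rho> c 1) = cscale 1 (?\<rho> c 1)"
    by (simp only: residual_weight_triple_2 cfun.scale_one)
  then show False
    using assms residual_weight_triple_nonzero cfun.scale_right_imp_eq by blast
qed

section \<open>Comparison of the parameters 1 and 2\<close>

theorem proposition8p4:
  shows "\<exists>(k::nat) (n::nat) act act' (\<Lambda>::weights) (\<Lambda>'::weights) (I::nat set).
    diagonal_action k n \<Lambda> act \<and> diagonal_action k n \<Lambda>' act' \<and>
    uniform_maximal_rank k n \<Lambda> \<and> uniform_maximal_rank k n \<Lambda>' \<and>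
    poincare_domain k n \<Lambda> \<and> poincare_domain k n \<Lambda>' \<and>
    I \<noteq> {} \<and> singular_support k n \<Lambda> I \<and> singular_support k n \<Lambda>' I \<and>
    krull_dim (quotient_ring k n \<Lambda> I) < enat (n - k) \<and>
    krull_dim (quotient_ring k n \<Lambda>' I) < enat (n - k) \<and>
    quotient_ring k n \<Lambda> I = quotient_ring k n \<Lambda>' I \<and>
    labelled_quotient_map k n \<Lambda> I = labelled_quotient_map k n \<Lambda>' I \<and>
    log_connection k n \<Lambda> I = log_connection k n \<Lambda>' I \<and>
    monodromy k n \<Lambda> I = monodromy k n \<Lambda>' I \<and>
    \<not> linearly_equivalent_residual k n \<Lambda> \<Lambda>' I \<and>
    (\<exists>j1 j2. j1 \<noteq> j2 \<and> {..<n} - I = {j1, j2} \<and>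
       cfun.dim (isotropy k \<Lambda> I) = 1 \<and> cfun.dim (isotropy k \<Lambda>' I) = 1 \<and>
       (\<forall>j\<in>{j1, j2}. residual_weight k \<Lambda> I j \<noteq> 0 \<and> residual_weight k \<Lambda>' I j \<noteq> 0) \<and>
       (\<forall>\<xi>\<in>isotropy k \<Lambda> I - {0}. \<forall>\<xi>'\<in>isotropy k \<Lambda>' I - {0}.
          transverse_index n \<Lambda> I \<xi> j1 j2 \<noteq> transverse_index n \<Lambda>' I \<xi>' j1 j2 \<and>
          transverse_index n \<Lambda> I \<xi> j2 j1 \<noteq> transverse_index n \<Lambda>' I \<xi>' j2 j1))"
proof -
  have act: "\<exists>act. diagonal_action 2 3 (triple c) act" for c
    unfolding diagonal_action_def
    by (rule exI[of _ "\<lambda>t z j. if j < 3 then exp (triple c j t) * z j else 0"])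
      (simp add: weight_configuration_triple)
  obtain act act' where acts: "diagonal_action 2 3 (triple 1) act" "diagonal_action 2 3 (triple 2) act'"
    using act by blast
  have mon: "resonance_monoid 2 3 (triple 1) {0} = {0}" "resonance_monoid 2 3 (triple 2) {0} = {0}"
    by (simp_all add: resonance_monoid_triple)
  have umr: "uniform_maximal_rank 2 3 (triple 1)" "uniform_maximal_rank 2 3 (triple 2)"
    by (simp_all add: uniform_maximal_rank_triple)
  \<comment> \<open>A single support weight spans a line, of dimension 1 < k = 2.\<close>
  have sing: "singular_support 2 3 (triple c) {0}" if "uniform_maximal_rank 2 3 (triple c)" for c
  proof -
    have "cfun.dim (cfun.span (triple c ` {0})) = min (card {0 :: nat}) 2"
      using that unfolding uniform_maximal_rank_def by (rule allE[of _ "{0}"]) simp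
    then show ?thesis by (simp add: singular_support_def)
  qed
  have quot: "quotient_ring 2 3 (triple 1) {0} = quotient_ring 2 3 (triple 2) {0}"
    by (simp add: quotient_ring_def mon)
  \<comment> \<open>Since n - k = 1, the strict bound asks for dimension 0: the quotient is a
    point.\<close>
  have dims: "krull_dim (quotient_ring 2 3 (triple 1) {0}) < enat (3 - 2)"
    "krull_dim (quotient_ring 2 3 (triple 2) {0}) < enat (3 - 2)"
    by (simp_all add: quotient_ring_def mon krull_dim_trivial_monoid_algebra zero_enat_def)
  have quot_map: "labelled_quotient_map 2 3 (triple 1) {0} = labelled_quotient_map 2 3 (triple 2) {0}"
    by (simp add: labelled_quotient_map_def quot)
  have conn: "log_connection 2 3 (triple 1) {0} = log_connection 2 3 (triple 2) {0}"
    by (intro log_connection_cong mon) simp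
  have monodr: "monodromy 2 3 (triple 1) {0} = monodromy 2 3 (triple 2) {0}"
    by (intro monodromy_cong mon) simp
  have nz: "residual_weight 2 (triple c) {0} j \<noteq> 0" if "c \<noteq> 0" "j \<in> {1, 2}" for c j
    using that residual_weight_triple_nonzero[of c]
    by (auto simp: residual_weight_triple_2 cfun.scale_eq_0_iff)
  \<comment> \<open>The indices are 1 and 1 for the first action, 2 and 1/2 for the second, so they
    differ along both separatrices.\<close>
  have idx: "transverse_index 3 (triple 1) {0} \<xi> 1 2 \<noteq> transverse_index 3 (triple 2) {0} \<xi>' 1 2 \<and>
      transverse_index 3 (triple 1) {0} \<xi> 2 1 \<noteq> transverse_index 3 (triple 2) {0} \<xi>' 2 1"
    if "\<xi> \<in> isotropy 2 (triple 1) {0} - {0}" "\<xi>' \<in> isotropy 2 (triple 2) {0} - {0}" for \<xi> \<xi>'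
    using transverse_index_triple[OF that(1)] transverse_index_triple[OF that(2)] by auto
  have pair: "\<exists>j1 j2. j1 \<noteq> j2 \<and> {..<3} - {0} = {j1, j2} \<and>
       cfun.dim (isotropy 2 (triple 1) {0}) = 1 \<and> cfun.dim (isotropy 2 (triple 2) {0}) = 1 \<and>
       (\<forall>j\<in>{j1, j2}. residual_weight 2 (triple 1) {0} j \<noteq> 0 \<and> residual_weight 2 (triple 2) {0} j \<noteq> 0) \<and>
       (\<forall>\<xi>\<in>isotropy 2 (triple 1) {0} - {0}. \<forall>\<xi>'\<in>isotropy 2 (triple 2) {0} - {0}.
          transverse_index 3 (triple 1) {0} \<xi> j1 j2 \<noteq> transverse_index 3 (triple 2) {0} \<xi>' j1 j2 \<and>
          transverse_index 3 (triple 1) {0} \<xi> j2 j1 \<noteq> transverse_index 3 (triple 2) {0} \<xi>' j2 j1)"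
  proof (intro exI conjI ballI)
    show "{..<3} - {0} = {1, 2 :: nat}" by (rule support_complement)
  qed (use idx nz in \<open>simp_all add: dim_isotropy_triple\<close>)
  show ?thesis
    by (rule exI[of _ 2], rule exI[of _ 3], rule exI[of _ act], rule exI[of _ act'],
        rule exI[of _ "triple 1"], rule exI[of _ "triple 2"], rule exI[of _ "{0}"],
        intro conjI acts umr sing quot dims quot_map conn monodr pair poincare_domain_triple
          not_linearly_equivalent_triple) simp_all
qed

end
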